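(* Let $\|\cdot\|_V$ be a norm on $\mathbb{R}^N$, let $\Phi$ be an $m\times N$ real matrix, and let $n\ge1$. For any norm $\|\cdot\|_Z$ on $\mathbb{R}^m$, one has $$S(\alpha_Z)\ \text{and}\ IS(2n,\mu_Z)\ \Rightarrow\ NSP(2n,C_1),\qquad C_1=1+\alpha_Z\mu_Z.$$ Conversely, let $\|\cdot\|_W$ be the Riesz norm, so that $\|\Phi u\|_W=\min_{\Phi v=\Phi u}\|v\|_V$ for $u\in\mathbb{R}^N$. Then $$NSP(2n,C_1)\ \Rightarrow\ S(\alpha_W)\ \text{and}\ IS(2n,\mu_W),\qquad \alpha_W=1\ \text{and}\ \mu_W=1+C_1,$$ where $S(\alpha_W)$ and $IS(2n,\mu_W)$ are the stability properties with respect to the norm $\|\cdot\|_Z=\|\cdot\|_W$.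
   Context: For an integer $k\ge1$, let $V_k:=\{u\in\mathbb{R}^N : \#\{i:u_i\ne0\}\le k\}$ be the set of $k$-sparse vectors, $e_k(u)_V:=\min_{v\in V_k}\|u-v\|_V$ the best $k$-term approximation error, and $\mathcal{N}:=\{v\in\mathbb{R}^N:\Phi v=0\}$ the null space of $\Phi$. Properties of $\Phi$ (relative to $\|\cdot\|_V$, and to $\|\cdot\|_Z$ for the last two): - $NSP(k,C_1)$ (null space property of order $k$ with constant $C_1$): $\|v\|_V\le C_1e_k(v)_V$ for all $v\in\mathcal{N}$. - $S(\alpha_Z)$ (stability): $\|\Phi u\|_Z\le\alpha_Z\|u\|_V$ for all $u\in\mathbb{R}^N$. - $IS(2n,\mu_Z)$ (inverse stability): $\|v\|_V\le\mu_Z\|\Phi v\|_Z$ for all $v\in V_{2n}$. The Riesz norm is $\|z\|_W=\min\{\|v\|_V : v\in\mathbb{R}^N,\ \Phi v=z\}$ for $z$ in the range of $\Phi$ (only its values on the range of $\Phi$ are used).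
   Formalization: In the converse the constant C_1 is assumed nonnegative; for C_1<0, NSP(2n,C_1) holds exactly when Φ is injective, and then IS(2n,1+C_1) fails (e.g. Φ the identity, C_1=-1/2). *)

theory Defs
  imports "HOL-Analysis.Analysis"
begin

definition norm_on :: "'a::real_vector set \<Rightarrow> ('a \<Rightarrow> real) \<Rightarrow> bool" where
  "norm_on S \<nu> \<longleftrightarrow>
     (\<forall>x\<in>S. 0 \<le> \<nu> x) \<and>
     (\<forall>x\<in>S. \<nu> x = 0 \<longleftrightarrow> x = 0) \<and>
     (\<forall>a. \<forall>x\<in>S. \<nu> (a *\<^sub>R x) = \<bar>a\<bar> * \<nu> x) \<and>
     (\<forall>x\<in>S. \<forall>y\<in>S. \<nu> (x + y) \<le> \<nu> x + \<nu> y)"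

definition sparse :: "nat \<Rightarrow> (real ^ 'N) set" where
  "sparse k = {u. card {i. u $ i \<noteq> 0} \<le> k}"

text \<open>The infimum is a minimum whenever \<open>\<nu>V\<close> is a norm, see \<open>best_approx_attained\<close>.\<close>

definition best_approx :: "(real ^ 'N \<Rightarrow> real) \<Rightarrow> nat \<Rightarrow> real ^ 'N \<Rightarrow> real" where
  "best_approx \<nu>V k u = (INF v\<in>sparse k. \<nu>V (u - v))"

definition null_space :: "real ^ 'N ^ 'm \<Rightarrow> (real ^ 'N) set" where
  "null_space \<Phi> = {v. \<Phi> *v v = 0}"

definition NSP :: "real ^ 'N ^ 'm \<Rightarrow> (real ^ 'N \<Rightarrow> real) \<Rightarrow> nat \<Rightarrow> real \<Rightarrow> bool" where
  "NSP \<Phi> \<nu>V k C \<longleftrightarrow> (\<forall>v\<in>null_space \<Phi>. \<nu>V v \<le> C * best_approx \<nu>V k v)"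

definition stable ::
  "real ^ 'N ^ 'm \<Rightarrow> (real ^ 'N \<Rightarrow> real) \<Rightarrow> (real ^ 'm \<Rightarrow> real) \<Rightarrow> real \<Rightarrow> bool" where
  "stable \<Phi> \<nu>V \<nu>Z \<alpha> \<longleftrightarrow> (\<forall>u. \<nu>Z (\<Phi> *v u) \<le> \<alpha> * \<nu>V u)"

definition inverse_stable ::
  "real ^ 'N ^ 'm \<Rightarrow> (real ^ 'N \<Rightarrow> real) \<Rightarrow> (real ^ 'm \<Rightarrow> real) \<Rightarrow> nat \<Rightarrow> real \<Rightarrow> bool" where
  "inverse_stable \<Phi> \<nu>V \<nu>Z k \<mu> \<longleftrightarrow> (\<forall>v\<in>sparse k. \<nu>V v \<le> \<mu> * \<nu>Z (\<Phi> *v v))"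

text \<open>
  Only the values on the range of \<open>\<Phi>\<close> are meaningful. There the infimum is a
  minimum, see \<open>riesz_norm_attained\<close>, and it defines a norm, see
  \<open>norm_on_riesz_norm\<close>.
\<close>

definition riesz_norm :: "real ^ 'N ^ 'm \<Rightarrow> (real ^ 'N \<Rightarrow> real) \<Rightarrow> real ^ 'm \<Rightarrow> real" where
  "riesz_norm \<Phi> \<nu>V z = (INF v\<in>{v. \<Phi> *v v = z}. \<nu>V v)"

lemma norm_onD:
  assumes "norm_on UNIV \<nu>"
  shows norm_on_nonneg: "0 \<le> \<nu> x"
    and norm_on_eq_0: "\<nu> x = 0 \<longleftrightarrow> x = 0"
    and norm_on_scale: "\<nu> (a *\<^sub>R x) = \<bar>a\<bar> * \<nu> x"
    and norm_on_triangle: "\<nu> (x + y) \<le> \<nu> x + \<nu> y"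
  using assms by (auto simp: norm_on_def)

lemma norm_on_minus:
  assumes "norm_on UNIV \<nu>"
  shows "\<nu> (- x) = \<nu> x"
  using norm_on_scale[OF assms, of "-1" x] by simp

lemma norm_on_sum:
  assumes "norm_on UNIV \<nu>" "finite A"
  shows "\<nu> (\<Sum>i\<in>A. f i) \<le> (\<Sum>i\<in>A. \<nu> (f i))"
  using assms(2)
proof (induction A rule: finite_induct)
  case empty
  then show ?case using norm_on_eq_0[OF assms(1), of 0] by simp
next
  case (insert a A)
  then show ?case using norm_on_triangle[OF assms(1), of "f a" "sum f A"] by simp
qed

lemma norm_on_continuous:
  fixes \<nu> :: "real ^ 'N \<Rightarrow> real"
  assumes N: "norm_on UNIV \<nu>"
  shows "continuous_on S \<nu>"
proof -
  define B where "B = (\<Sum>i\<in>UNIV. \<nu> (axis i 1 :: real ^ 'N))"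
  have B0: "0 \<le> B" unfolding B_def by (intro sum_nonneg norm_on_nonneg[OF N])
  have bound: "\<nu> x \<le> B * norm x" for x
  proof -
    have "x = (\<Sum>i\<in>UNIV. x $ i *\<^sub>R axis i 1)"
      by (simp add: vec_eq_iff axis_def if_distrib sum.delta cong: if_cong)
    then have "\<nu> x \<le> (\<Sum>i\<in>UNIV. \<nu> (x $ i *\<^sub>R axis i 1))"
      using norm_on_sum[OF N, of UNIV "\<lambda>i. x $ i *\<^sub>R axis i 1"] by simp
    also have "\<dots> \<le> (\<Sum>i\<in>UNIV. norm x * \<nu> (axis i 1))"
      by (intro sum_mono) (simp add: norm_on_scale[OF N] mult_right_mono
          norm_on_nonneg[OF N] component_le_norm_cart)
    finally show ?thesis by (simp add: B_def sum_distrib_left mult.commute)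
  qed
  have "\<nu> x - \<nu> y \<le> B * dist x y" for x y
    using norm_on_triangle[OF N, of "x - y" y] bound[of "x - y"] by (simp add: dist_norm)
  then have "dist (\<nu> x) (\<nu> y) \<le> B * dist x y" for x y
    by (metis abs_le_iff dist_commute dist_real_def minus_diff_eq)
  then have "B-lipschitz_on S \<nu>" by (intro lipschitz_onI B0)
  then show ?thesis by (rule lipschitz_on_continuous_on)
qed

lemma norm_on_lower:
  fixes \<nu> :: "real ^ 'N \<Rightarrow> real"
  assumes N: "norm_on UNIV \<nu>"
  obtains c where "0 < c" "\<And>x. c * norm x \<le> \<nu> x"
proof -
  have "sphere (0 :: real ^ 'N) 1 \<noteq> {}" by simp
  then obtain x where x: "x \<in> sphere 0 1" "\<And>y. y \<in> sphere 0 1 \<Longrightarrow> \<nu> x \<le> \<nu> y"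
    using continuous_attains_inf[OF compact_sphere _ norm_on_continuous[OF N]] by metis
  show thesis
  proof
    show "0 < \<nu> x"
      using x(1) norm_on_nonneg[OF N, of x] norm_on_eq_0[OF N, of x] by force
    fix y :: "real ^ 'N"
    show "\<nu> x * norm y \<le> \<nu> y"
    proof (cases "y = 0")
      case True
      then show ?thesis using norm_on_nonneg[OF N] by simp
    next
      case False
      have "\<nu> x \<le> \<nu> ((1 / norm y) *\<^sub>R y)" by (rule x(2)) (simp add: False)
      then show ?thesis using False by (simp add: norm_on_scale[OF N] field_simps)
    qed
  qed
qed

lemma norm_on_attains_inf:
  fixes \<nu> :: "real ^ 'N \<Rightarrow> real"
  assumes N: "norm_on UNIV \<nu>" and S: "closed S" "S \<noteq> {}"
  shows "\<exists>v\<in>S. (INF w\<in>S. \<nu> (u - w)) = \<nu> (u - v) \<and> (\<forall>w\<in>S. \<nu> (u - v) \<le> \<nu> (u - w))"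
proof -
  obtain c where c: "0 < c" "\<And>x. c * norm x \<le> \<nu> x" using norm_on_lower[OF N] by blast
  obtain w0 where w0: "w0 \<in> S" using S by blast
  define K where "K = S \<inter> cball u (\<nu> (u - w0) / c)"
  have in_ball: "w \<in> cball u (\<nu> (u - w0) / c)" if "\<nu> (u - w) \<le> \<nu> (u - w0)" for w
    using c(2)[of "u - w"] that c(1) by (simp add: dist_norm field_simps)
  have "compact K" unfolding K_def using S by (intro closed_Int_compact) auto
  moreover have "w0 \<in> K" using w0 in_ball by (simp add: K_def)
  moreover have "continuous_on K (\<lambda>w. \<nu> (u - w))"
    by (rule continuous_on_compose2[OF norm_on_continuous[OF N, of UNIV]])
      (auto intro!: continuous_intros)
  ultimately obtain v where v: "v \<in> K" "\<And>w. w \<in> K \<Longrightarrow> \<nu> (u - v) \<le> \<nu> (u - w)"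
    using continuous_attains_inf[of K "\<lambda>w. \<nu> (u - w)"] by blast
  have min: "\<nu> (u - v) \<le> \<nu> (u - w)" if "w \<in> S" for w
  proof (cases "\<nu> (u - w) \<le> \<nu> (u - w0)")
    case True
    then show ?thesis using v(2) in_ball that by (simp add: K_def)
  next
    case False
    then show ?thesis using v(2)[OF \<open>w0 \<in> K\<close>] by linarith
  qed
  have vS: "v \<in> S" using v(1) by (simp add: K_def)
  have "(INF w\<in>S. \<nu> (u - w)) = \<nu> (u - v)"
    by (rule cInf_eq_minimum) (use vS min in auto)
  then show ?thesis using vS min by blast
qed

lemma closed_sparse: "closed (sparse k :: (real ^ 'N) set)"
proof -
  have "(sparse k :: (real ^ 'N) set) =
      (\<Union>A\<in>{A. card A \<le> k}. \<Inter>i\<in>- A. {u. u $ i = 0})" (is "_ = ?R")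
  proof
    show "sparse k \<subseteq> ?R" by (force simp: sparse_def)
    show "?R \<subseteq> sparse k"
    proof
      fix u :: "real ^ 'N" assume "u \<in> ?R"
      then obtain A where A: "card A \<le> k" "\<And>i. i \<notin> A \<Longrightarrow> u $ i = 0" by auto
      then have "card {i. u $ i \<noteq> 0} \<le> card A" by (intro card_mono) auto
      then show "u \<in> sparse k" using A(1) by (simp add: sparse_def)
    qed
  qed
  moreover have "closed ?R"
    by (intro closed_UN closed_INT ballI closed_Collect_eq continuous_intros) auto
  ultimately show ?thesis by simp
qed

lemma best_approx_attained:
  assumes "norm_on UNIV \<nu>V"
  shows "\<exists>v\<in>sparse k. best_approx \<nu>V k u = \<nu>V (u - v) \<and>
           (\<forall>w\<in>sparse k. \<nu>V (u - v) \<le> \<nu>V (u - w))"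
proof -
  have "0 \<in> sparse k" by (simp add: sparse_def)
  then show ?thesis
    unfolding best_approx_def by (intro norm_on_attains_inf assms closed_sparse) auto
qed

lemma riesz_norm_attained:
  assumes N: "norm_on UNIV \<nu>V" and z: "z \<in> range ((*v) \<Phi>)"
  shows "\<exists>v. \<Phi> *v v = z \<and> riesz_norm \<Phi> \<nu>V z = \<nu>V v \<and>
           (\<forall>w. \<Phi> *v w = z \<longrightarrow> \<nu>V v \<le> \<nu>V w)"
proof -
  have "closed {v. \<Phi> *v v = z}"
    by (intro closed_Collect_eq matrix_vector_mult_linear_continuous_on continuous_on_const)
  moreover have "{v. \<Phi> *v v = z} \<noteq> {}" using z by auto
  ultimately show ?thesis
    using norm_on_attains_inf[OF N, of "{v. \<Phi> *v v = z}" 0]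
    by (auto simp: riesz_norm_def norm_on_minus[OF N])
qed

lemma norm_on_riesz_norm:
  assumes N: "norm_on UNIV \<nu>V"
  shows "norm_on (range ((*v) \<Phi>)) (riesz_norm \<Phi> \<nu>V)"
proof -
  let ?R = "range ((*v) \<Phi>)" and ?W = "riesz_norm \<Phi> \<nu>V"
  note att = riesz_norm_attained[OF N]
  have le: "?W (\<Phi> *v v) \<le> \<nu>V v" for v using att[of "\<Phi> *v v" \<Phi>] by auto
  have nn: "0 \<le> ?W x" if "x \<in> ?R" for x
    using att[OF that] norm_on_nonneg[OF N] by metis
  have W0: "?W 0 = 0"
    using le[of 0] nn[of 0] norm_on_eq_0[OF N, of 0]
    by (metis matrix_vector_mult_0_right order_antisym rangeI)
  have sc_le: "?W (a *\<^sub>R x) \<le> \<bar>a\<bar> * ?W x" if "x \<in> ?R" for a x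
  proof -
    obtain v where "\<Phi> *v v = x" "?W x = \<nu>V v" using att[OF \<open>x \<in> ?R\<close>] by blast
    then show ?thesis
      using le[of "a *\<^sub>R v"] by (simp add: norm_on_scale[OF N] matrix_vector_mult_scaleR)
  qed
  have sc: "?W (a *\<^sub>R x) = \<bar>a\<bar> * ?W x" if x: "x \<in> ?R" for a x
  proof (cases "a = 0")
    case True
    then show ?thesis by (simp add: W0)
  next
    case False
    have "a *\<^sub>R x \<in> ?R" using x by (auto simp flip: matrix_vector_mult_scaleR)
    then have "?W x \<le> \<bar>1 / a\<bar> * ?W (a *\<^sub>R x)"
      using sc_le[of "a *\<^sub>R x" "1 / a"] False by simp
    then show ?thesis using sc_le[OF x, of a] False by (simp add: field_simps)
  qed
  have "?W (x + y) \<le> ?W x + ?W y" if xy: "x \<in> ?R" "y \<in> ?R" for x y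
  proof -
    obtain v w where "\<Phi> *v v = x" "?W x = \<nu>V v" "\<Phi> *v w = y" "?W y = \<nu>V w"
      using att xy by metis
    then show ?thesis
      using le[of "v + w"] norm_on_triangle[OF N, of v w]
      by (simp add: matrix_vector_right_distrib)
  qed
  moreover have "?W x = 0 \<longleftrightarrow> x = 0" if "x \<in> ?R" for x
    using att[OF that] norm_on_eq_0[OF N] W0 by (metis matrix_vector_mult_0_right)
  ultimately show ?thesis using nn sc by (simp add: norm_on_def)
qed

end

theory Submission
  imports Defs
begin

text \<open>
  Both directions compare a vector with one well-chosen companion and apply the triangle
  inequality once.

  If \<open>\<Phi> v = 0\<close> and \<open>w\<close> is a best sparse approximation of \<open>v\<close>, then \<open>\<Phi>\<close> cannot
  tell \<open>w\<close> from \<open>w - v\<close>. Inverse stability thus bounds \<open>w\<close> by \<open>\<Phi> w = \<Phi> (w - v)\<close>, and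
  stability bounds this by the error \<open>v - w\<close>: the size of \<open>w\<close>, hence that of \<open>v\<close>, is
  controlled by the approximation error.

  Conversely, if \<open>v\<close> is sparse and \<open>w\<close> is a vector of least norm with \<open>\<Phi> w = \<Phi> v\<close>, then
  \<open>v - w\<close> is in the null space and \<open>v\<close> itself is a sparse candidate for approximating it, with
  error exactly \<open>w\<close>. The null space property then bounds \<open>v - w\<close>, hence \<open>v\<close>, by the norm of
  \<open>w\<close>, which is the Riesz norm of \<open>\<Phi> v\<close>.

  Both directions rely on the two minima being attained (\<open>best_approx_attained\<close>,
  \<open>riesz_norm_attained\<close>).
\<close>

lemma best_approx_le:
  assumes "norm_on UNIV \<nu>V" and "w \<in> sparse k"
  shows "best_approx \<nu>V k u \<le> \<nu>V (u - w)"
  using best_approx_attained[OF assms(1), of k u] assms(2) by auto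

lemma riesz_norm_le:
  assumes "norm_on UNIV \<nu>V"
  shows "riesz_norm \<Phi> \<nu>V (\<Phi> *v v) \<le> \<nu>V v"
  using riesz_norm_attained[OF assms, of "\<Phi> *v v" \<Phi>] by auto

text \<open>
  A unit vector is sparse as soon as \<open>k \<ge> 1\<close> and has positive norm, which a negative constant
  could not bound. For \<open>k = 0\<close> inverse stability only concerns the zero vector and allows every
  \<open>\<mu>\<close>.
\<close>

lemma inverse_stable_const_nonneg:
  fixes \<Phi> :: "real ^ 'N ^ 'm"
  assumes V: "norm_on UNIV \<nu>V" and Z: "norm_on UNIV \<nu>Z"
    and IS: "inverse_stable \<Phi> \<nu>V \<nu>Z k \<mu>" and "k \<ge> 1"
  shows "0 \<le> \<mu>"
proof (rule ccontr)
  assume "\<not> 0 \<le> \<mu>"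
  define e :: "real ^ 'N" where "e = axis undefined 1"
  have "{i. e $ i \<noteq> 0} = {undefined}" by (auto simp: e_def axis_def)
  then have "e \<in> sparse k" using \<open>k \<ge> 1\<close> by (simp add: sparse_def)
  then have "\<nu>V e \<le> \<mu> * \<nu>Z (\<Phi> *v e)" using IS by (simp add: inverse_stable_def)
  also have "\<dots> \<le> 0"
    using \<open>\<not> 0 \<le> \<mu>\<close> norm_on_nonneg[OF Z] by (simp add: mult_nonpos_nonneg)
  finally have "e = 0" using norm_on_nonneg[OF V, of e] norm_on_eq_0[OF V, of e] by simp
  then show False by (simp add: e_def axis_eq_0_iff)
qed

lemma NSP_if_stable_inverse_stable:
  assumes V: "norm_on UNIV \<nu>V" and Z: "norm_on UNIV \<nu>Z"
    and S: "stable \<Phi> \<nu>V \<nu>Z \<alpha>" and IS: "inverse_stable \<Phi> \<nu>V \<nu>Z k \<mu>" and "k \<ge> 1"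
  shows "NSP \<Phi> \<nu>V k (1 + \<alpha> * \<mu>)"
  unfolding NSP_def
proof
  fix v assume "v \<in> null_space \<Phi>"
  then have v: "\<Phi> *v v = 0" by (simp add: null_space_def)
  obtain w where w: "w \<in> sparse k" "best_approx \<nu>V k v = \<nu>V (v - w)"
    using best_approx_attained[OF V] by blast
  have "\<Phi> *v w = \<Phi> *v (w - v)" using v by (simp add: matrix_vector_mult_diff_distrib)
  then have "\<nu>Z (\<Phi> *v w) \<le> \<alpha> * \<nu>V (w - v)" using S by (simp add: stable_def)
  also have "\<nu>V (w - v) = \<nu>V (v - w)" using norm_on_minus[OF V, of "v - w"] by simp
  finally have Zw: "\<nu>Z (\<Phi> *v w) \<le> \<alpha> * \<nu>V (v - w)" .
  have "\<nu>V v \<le> \<nu>V (v - w) + \<nu>V w" using norm_on_triangle[OF V, of "v - w" w] by simp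
  also have "\<nu>V w \<le> \<mu> * \<nu>Z (\<Phi> *v w)" using IS w(1) by (simp add: inverse_stable_def)
  also have "\<dots> \<le> \<mu> * (\<alpha> * \<nu>V (v - w))"
    using Zw inverse_stable_const_nonneg[OF V Z IS \<open>k \<ge> 1\<close>] by (rule mult_left_mono)
  finally show "\<nu>V v \<le> (1 + \<alpha> * \<mu>) * best_approx \<nu>V k v"
    by (simp add: w(2) algebra_simps)
qed

lemma inverse_stable_riesz_norm_if_NSP:
  fixes \<Phi> :: "real ^ 'N ^ 'm"
  assumes V: "norm_on UNIV \<nu>V" and NSP: "NSP \<Phi> \<nu>V k C" and "C \<ge> 0"
  shows "inverse_stable \<Phi> \<nu>V (riesz_norm \<Phi> \<nu>V) k (1 + C)"
  unfolding inverse_stable_def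
proof
  fix v :: "real ^ 'N" assume v: "v \<in> sparse k"
  obtain w where w: "\<Phi> *v w = \<Phi> *v v" "riesz_norm \<Phi> \<nu>V (\<Phi> *v v) = \<nu>V w"
    using riesz_norm_attained[OF V, of "\<Phi> *v v" \<Phi>] by blast
  have "v - w \<in> null_space \<Phi>"
    using w(1) by (simp add: null_space_def matrix_vector_mult_diff_distrib)
  then have "\<nu>V (v - w) \<le> C * best_approx \<nu>V k (v - w)" using NSP by (simp add: NSP_def)
  also have "\<dots> \<le> C * \<nu>V ((v - w) - v)"
    using best_approx_le[OF V v] \<open>C \<ge> 0\<close> by (rule mult_left_mono)
  also have "\<nu>V ((v - w) - v) = \<nu>V w" using norm_on_minus[OF V, of w] by simp
  finally have "\<nu>V (v - w) \<le> C * \<nu>V w" .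
  then show "\<nu>V v \<le> (1 + C) * riesz_norm \<Phi> \<nu>V (\<Phi> *v v)"
    using norm_on_triangle[OF V, of "v - w" w] by (simp add: w(2) algebra_simps)
qed

theorem theorem6p2:
  fixes \<Phi> :: "real ^ 'N ^ 'm" and \<nu>V :: "real ^ 'N \<Rightarrow> real" and n :: nat
  assumes "norm_on UNIV \<nu>V" and "n \<ge> 1"
  shows "(\<forall>(\<nu>Z :: real ^ 'm \<Rightarrow> real) \<alpha>Z \<mu>Z.
            norm_on UNIV \<nu>Z \<longrightarrow> stable \<Phi> \<nu>V \<nu>Z \<alpha>Z \<longrightarrow> inverse_stable \<Phi> \<nu>V \<nu>Z (2 * n) \<mu>Z \<longrightarrow>
            NSP \<Phi> \<nu>V (2 * n) (1 + \<alpha>Z * \<mu>Z))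
       \<and> (\<forall>C1\<ge>0. NSP \<Phi> \<nu>V (2 * n) C1 \<longrightarrow>
            stable \<Phi> \<nu>V (riesz_norm \<Phi> \<nu>V) 1 \<and>
            inverse_stable \<Phi> \<nu>V (riesz_norm \<Phi> \<nu>V) (2 * n) (1 + C1))"
proof (intro conjI allI impI)
  fix \<nu>Z :: "real ^ 'm \<Rightarrow> real" and \<alpha>Z \<mu>Z
  assume "norm_on UNIV \<nu>Z" "stable \<Phi> \<nu>V \<nu>Z \<alpha>Z" "inverse_stable \<Phi> \<nu>V \<nu>Z (2 * n) \<mu>Z"
  then show "NSP \<Phi> \<nu>V (2 * n) (1 + \<alpha>Z * \<mu>Z)"
    using \<open>n \<ge> 1\<close> by (intro NSP_if_stable_inverse_stable[OF assms(1)]) auto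
next
  show "stable \<Phi> \<nu>V (riesz_norm \<Phi> \<nu>V) 1"
    using riesz_norm_le[OF assms(1), of \<Phi>] by (simp add: stable_def)
next
  fix C1 :: real
  assume "0 \<le> C1" "NSP \<Phi> \<nu>V (2 * n) C1"
  then show "inverse_stable \<Phi> \<nu>V (riesz_norm \<Phi> \<nu>V) (2 * n) (1 + C1)"
    by (intro inverse_stable_riesz_norm_if_NSP[OF assms(1)])
qed

end
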